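(* Let $M$ be the monoid defined by the monoid presentation $\langle A\mid R\rangle$, let $\theta:A^*\to M$ be the natural surjective homomorphism, let $\rho$ be a right congruence on $M$, let $\Gamma=(V,E)$ be the word graph of $\rho$, and let $\Psi:V\times M\to V$ be the associated right action. If $P\subseteq A^*\times A^*$ is such that $(P)\theta$ contains a generating pair for every principal 2-sided congruence of $M$, then $\Psi$ is faithful if and only if for all $(u,v)\in P$ there exists some $\alpha\in V$ with $\alpha\cdot u\neq\alpha\cdot v$.
   Context: Functions are written to the right of their arguments. $A=\{a_0<a_1<\dots<a_{k-1}\}$ is a linearly ordered alphabet, $A^*$ is the free monoid on $A$ with identity the empty word $\varepsilon$, and $R\subseteq A^*\times A^*$. $R^{\#}$ is the least 2-sided congruence on $A^*$ containing $R$; the monoid defined by $\langle A\mid R\rangle$ is $M\cong A^*/R^{\#}$, and $\theta:A^*\to M$ is the natural surjective homomorphism, with $\ker(\theta)=R^{\#}$. For $T\subseteq A^*\times A^*$ write $(T)\theta=\{((u)\theta,(v)\theta):(u,v)\in T\}$. A right congruence on $M$ is an equivalence relation $\rho$ on $M$ with $(xs,ys)\in\rho$ for all $(x,y)\in\rho$ and $s\in M$; left congruences are defined dually, and a 2-sided congruence is both a left and a right congruence. A 2-sided congruence $\sigma$ on $M$ is principal if there exists $(s,t)\in M\times M$ with $s\neq t$ such that $\sigma$ is the least 2-sided congruence containing $(s,t)$; such a pair $(s,t)$ is called a generating pair of $\sigma$. A word graph over $A$ is a digraph $\Gamma=(V,E)$ with edges $E\subseteq V\times A\times V$; an edge $(\alpha,a,\beta)$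 has source $\alpha$, label $a$ and target $\beta$. It is assumed that the node set of a word graph is $V=\{0,\ldots,n-1\}$ for some $n\geq 1$. A word graph is complete (respectively deterministic) if for every node $\alpha$ and every $a\in A$ there is at least (respectively at most) one edge with source $\alpha$ and label $a$. A path is labelled by the product of the labels of its edges, and the empty path at any node is labelled by $\varepsilon$. Write $\alpha\cdot u=\beta$ if $u\in A^*$ labels a path from $\alpha$ to $\beta$ (an $(\alpha,\beta)$-path), and $\alpha\cdot u=\bot$ (undefined) if $u$ labels no path with source $\alpha$. The path relation of $\Gamma$ is given by $(\alpha)\pi_\Gamma=\{(u,v)\in A^*\times A^*:\alpha\cdot u\neq\bot\text{ and }\alpha\cdot u=\alpha\cdot v\}$ for $\alpha\in V$. $\Gamma$ is compatible with $R$ if for all $(u,v)\in R$ and all $\alpha\in V$, $\alpha\cdot u=\alpha\cdot v$ whenever $\alpha\cdot u\neq\bot$ and $\alpha\cdot v\neq\bot$. In the short-lex order on $A^*$, $u<v$ if $|u|<|v|$, or $|u|=|v|$ and $u$ is strictly lexicographically smaller than $v$. For a node $\alpha$ reachable from $0$, $w_\alpha$ denotes the short-lex least word labelling a $(0,\alpha)$-path. A complete word graph $\Gamma=(V,E)$ over $A$ is standard if: $\Gamma$ is deterministic; every node is reachable from $0\in V=\{0,\ldots,|V|-1\}$; and for all $\alpha,\beta\in V$, $\alpha<\beta$ if and only if $w_\alpha<w_\beta$. The word graph of a right congruence $\rho$ on $M$ is the standard complete word graph $\Gamma$ over $A$ compatible with $R$ that corresponds to $\rho$, that is, the one with $\rho=((0)\pi_\Gamma)\theta$;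 its node $0$ corresponds to the $\rho$-class of the identity of $M$. The associated right action $\Psi:V\times M\to V$ is given by $(\alpha,(w)\theta)\Psi=\alpha\cdot w$ for all $\alpha\in V$ and $w\in A^*$. For $s\in M$ let $\Psi_s:V\to V$ be the transformation $\alpha\mapsto(\alpha,s)\Psi$; $\Psi$ is faithful if $\Psi_s=\Psi_t$ implies $s=t$ for all $s,t\in M$.
   Formalization: The direction "Ψ faithful implies every pair of P is separated" is stated only for P with (u)θ ≠ (v)θ for all (u,v) ∈ P, since a pair such as (ε,ε) in P makes it false; the converse direction is stated for all P. *)

theory Defs
  imports "HOL-Algebra.Group"
begin

section \<open>Monoids, congruences and presentations\<close>

definition free_monoid :: "'a set \<Rightarrow> 'a list monoid" where
  "free_monoid A = \<lparr>carrier = lists A, monoid.mult = (@), one = []\<rparr>"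

definition right_congruence :: "('m, 'x) monoid_scheme \<Rightarrow> ('m \<times> 'm) set \<Rightarrow> bool" where
  "right_congruence M \<rho> \<longleftrightarrow> equiv (carrier M) \<rho> \<and>
     (\<forall>(x, y) \<in> \<rho>. \<forall>s \<in> carrier M. (x \<otimes>\<^bsub>M\<^esub> s, y \<otimes>\<^bsub>M\<^esub> s) \<in> \<rho>)"

definition left_congruence :: "('m, 'x) monoid_scheme \<Rightarrow> ('m \<times> 'm) set \<Rightarrow> bool" where
  "left_congruence M \<rho> \<longleftrightarrow> equiv (carrier M) \<rho> \<and>
     (\<forall>(x, y) \<in> \<rho>. \<forall>s \<in> carrier M. (s \<otimes>\<^bsub>M\<^esub> x, s \<otimes>\<^bsub>M\<^esub> y) \<in> \<rho>)"

definition two_sided_congruence :: "('m, 'x) monoid_scheme \<Rightarrow> ('m \<times> 'm) set \<Rightarrow> bool" where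
  "two_sided_congruence M \<sigma> \<longleftrightarrow> left_congruence M \<sigma> \<and> right_congruence M \<sigma>"

definition least_congruence :: "('m, 'x) monoid_scheme \<Rightarrow> ('m \<times> 'm) set \<Rightarrow> ('m \<times> 'm) set" where
  "least_congruence M T = \<Inter> {\<sigma>. two_sided_congruence M \<sigma> \<and> T \<subseteq> \<sigma>}"

definition generating_pair ::
    "('m, 'x) monoid_scheme \<Rightarrow> ('m \<times> 'm) set \<Rightarrow> 'm \<times> 'm \<Rightarrow> bool" where
  "generating_pair M \<sigma> p \<longleftrightarrow> p \<in> carrier M \<times> carrier M \<and> fst p \<noteq> snd p \<and>
     \<sigma> = least_congruence M {p}"

definition principal_congruence :: "('m, 'x) monoid_scheme \<Rightarrow> ('m \<times> 'm) set \<Rightarrow> bool" where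
  "principal_congruence M \<sigma> \<longleftrightarrow> two_sided_congruence M \<sigma> \<and> (\<exists>p. generating_pair M \<sigma> p)"

text \<open>
  The monoid defined by a presentation is determined up to isomorphism by a surjective
  homomorphism from the free monoid whose kernel is the least congruence containing the relations.
\<close>

definition monoid_presentation ::
    "'a set \<Rightarrow> ('a list \<times> 'a list) set \<Rightarrow> ('m, 'x) monoid_scheme \<Rightarrow> ('a list \<Rightarrow> 'm) \<Rightarrow> bool" where
  "monoid_presentation A R M \<theta> \<longleftrightarrow> finite A \<and> R \<subseteq> lists A \<times> lists A \<and> monoid M \<and>
     \<theta> \<in> hom (free_monoid A) M \<and> \<theta> ` lists A = carrier M \<and>
     {(u, v) \<in> lists A \<times> lists A. \<theta> u = \<theta> v} = least_congruence (free_monoid A) R"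


section \<open>Word graphs\<close>

definition word_graph :: "'a set \<Rightarrow> nat set \<Rightarrow> (nat \<times> 'a \<times> nat) set \<Rightarrow> bool" where
  "word_graph A V E \<longleftrightarrow> (\<exists>n \<ge> 1. V = {..<n}) \<and> E \<subseteq> V \<times> A \<times> V"

definition complete_graph :: "'a set \<Rightarrow> nat set \<Rightarrow> (nat \<times> 'a \<times> nat) set \<Rightarrow> bool" where
  "complete_graph A V E \<longleftrightarrow> (\<forall>\<alpha> \<in> V. \<forall>a \<in> A. \<exists>\<beta>. (\<alpha>, a, \<beta>) \<in> E)"

definition deterministic_graph :: "'a set \<Rightarrow> nat set \<Rightarrow> (nat \<times> 'a \<times> nat) set \<Rightarrow> bool" where
  "deterministic_graph A V E \<longleftrightarrow>
     (\<forall>\<alpha> \<in> V. \<forall>a \<in> A. \<forall>\<beta> \<gamma>. (\<alpha>, a, \<beta>) \<in> E \<and> (\<alpha>, a, \<gamma>) \<in> E \<longrightarrow> \<beta> = \<gamma>)"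

inductive labels_path :: "(nat \<times> 'a \<times> nat) set \<Rightarrow> nat \<Rightarrow> 'a list \<Rightarrow> nat \<Rightarrow> bool"
  for E where
  empty: "labels_path E \<alpha> [] \<alpha>"
| step: "(\<alpha>, a, \<beta>) \<in> E \<Longrightarrow> labels_path E \<beta> u \<gamma> \<Longrightarrow> labels_path E \<alpha> (a # u) \<gamma>"

text \<open>
  The node reached from \<open>\<alpha>\<close> by the word \<open>u\<close>; \<open>None\<close> plays the role of \<open>\<bottom>\<close>.
  Only meaningful in deterministic word graphs, where the target is unique.
\<close>

definition target :: "(nat \<times> 'a \<times> nat) set \<Rightarrow> nat \<Rightarrow> 'a list \<Rightarrow> nat option" where
  "target E \<alpha> u =
     (if \<exists>\<beta>. labels_path E \<alpha> u \<beta> then Some (THE \<beta>. labels_path E \<alpha> u \<beta>) else None)"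

definition path_relation ::
    "'a set \<Rightarrow> (nat \<times> 'a \<times> nat) set \<Rightarrow> nat \<Rightarrow> ('a list \<times> 'a list) set" where
  "path_relation A E \<alpha> =
     {(u, v) \<in> lists A \<times> lists A. target E \<alpha> u \<noteq> None \<and> target E \<alpha> u = target E \<alpha> v}"

definition compatible ::
    "('a list \<times> 'a list) set \<Rightarrow> nat set \<Rightarrow> (nat \<times> 'a \<times> nat) set \<Rightarrow> bool" where
  "compatible R V E \<longleftrightarrow> (\<forall>(u, v) \<in> R. \<forall>\<alpha> \<in> V.
     target E \<alpha> u \<noteq> None \<and> target E \<alpha> v \<noteq> None \<longrightarrow> target E \<alpha> u = target E \<alpha> v)"

definition shortlex_less :: "'a::linorder list \<Rightarrow> 'a list \<Rightarrow> bool" where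
  "shortlex_less u v \<longleftrightarrow> (u, v) \<in> lenlex {(a, b). a < b}"

text \<open>Only meaningful for nodes reachable from \<open>0\<close>.\<close>

definition least_word :: "(nat \<times> 'a::linorder \<times> nat) set \<Rightarrow> nat \<Rightarrow> 'a list" where
  "least_word E \<alpha> = (THE w. labels_path E 0 w \<alpha> \<and>
     (\<forall>w'. labels_path E 0 w' \<alpha> \<and> w' \<noteq> w \<longrightarrow> shortlex_less w w'))"

definition standard_complete ::
    "'a::linorder set \<Rightarrow> nat set \<Rightarrow> (nat \<times> 'a \<times> nat) set \<Rightarrow> bool" where
  "standard_complete A V E \<longleftrightarrow> word_graph A V E \<and> complete_graph A V E \<and>
     deterministic_graph A V E \<and> (\<forall>\<alpha> \<in> V. \<exists>w. labels_path E 0 w \<alpha>) \<and>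
     (\<forall>\<alpha> \<in> V. \<forall>\<beta> \<in> V. \<alpha> < \<beta> \<longleftrightarrow> shortlex_less (least_word E \<alpha>) (least_word E \<beta>))"

definition word_graph_of_congruence ::
    "'a::linorder set \<Rightarrow> ('a list \<times> 'a list) set \<Rightarrow> ('a list \<Rightarrow> 'm) \<Rightarrow> ('m \<times> 'm) set \<Rightarrow>
     nat set \<Rightarrow> (nat \<times> 'a \<times> nat) set \<Rightarrow> bool" where
  "word_graph_of_congruence A R \<theta> \<rho> V E \<longleftrightarrow>
     standard_complete A V E \<and> compatible R V E \<and> \<rho> = map_prod \<theta> \<theta> ` path_relation A E 0"

text \<open>
  The value at \<open>(\<alpha>, s)\<close> is \<open>\<alpha> \<cdot> w\<close> for any word \<open>w\<close> representing \<open>s\<close>; for a complete word graph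
  compatible with the defining relations it does not depend on the choice of \<open>w\<close>.
\<close>

definition right_action ::
    "'a set \<Rightarrow> ('a list \<Rightarrow> 'm) \<Rightarrow> (nat \<times> 'a \<times> nat) set \<Rightarrow> nat \<Rightarrow> 'm \<Rightarrow> nat" where
  "right_action A \<theta> E \<alpha> s = (THE \<beta>. \<exists>w \<in> lists A. \<theta> w = s \<and> target E \<alpha> w = Some \<beta>)"

definition faithful :: "('m, 'x) monoid_scheme \<Rightarrow> nat set \<Rightarrow> (nat \<Rightarrow> 'm \<Rightarrow> nat) \<Rightarrow> bool" where
  "faithful M V \<Psi> \<longleftrightarrow>
     (\<forall>s \<in> carrier M. \<forall>t \<in> carrier M. (\<forall>\<alpha> \<in> V. \<Psi> \<alpha> s = \<Psi> \<alpha> t) \<longrightarrow> s = t)"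

end

theory Submission
  imports Defs
begin

text \<open>
  The kernel of the action, i.e. the set of pairs of elements of \<open>M\<close> that act in the same way on
  every node, is a two-sided congruence, and \<open>\<Psi>\<close> is faithful if and only if this kernel is trivial.
  A non-trivial two-sided congruence contains a pair of distinct elements, hence also the principal
  congruence generated by that pair, hence every generating pair of that principal congruence, and
  one of these is represented in \<open>P\<close>
  (\<open>two_sided_congruence_trivial_if_misses_generating_pairs\<close>). So if no pair in \<open>P\<close>
  represents a pair in the kernel, then the kernel is trivial. Conversely, if the kernel is trivial,
  then a pair of words representing distinct elements of \<open>M\<close> must be separated by some node.

  Carrying this out requires the action of \<open>M\<close> to be well defined, that is, words that represent the
  same element of \<open>M\<close> must lead from a given node to the same node. This is an instance of the first
  remark, applied to the free monoid: the kernel of its action by reading words along paths is a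
  two-sided congruence, it contains \<open>R\<close> because the graph is compatible with \<open>R\<close>, and so it contains
  the least two-sided congruence with this property, which is the kernel of \<open>\<theta>\<close>.

  No node separates a pair in \<open>P\<close> whose two words represent the same element of \<open>M\<close>. This is why
  faithfulness yields separation only for sets \<open>P\<close> without pairs of this kind.
\<close>

section \<open>Principal congruences\<close>

lemma two_sided_congruence_least_congruence:
  assumes "monoid M" and "T \<subseteq> carrier M \<times> carrier M"
  shows "two_sided_congruence M (least_congruence M T)"
proof -
  interpret monoid M by fact
  \<comment> \<open>The universal relation guarantees that the intersection is over a non-empty family.\<close>
  have full: "two_sided_congruence M (carrier M \<times> carrier M)"
    by (auto simp: two_sided_congruence_def left_congruence_def right_congruence_def
        equiv_def refl_on_def sym_def trans_def)
  have "equiv (carrier M) (least_congruence M T)"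
  proof (rule equivI)
    show "least_congruence M T \<subseteq> carrier M \<times> carrier M"
      using full assms(2) by (auto simp: least_congruence_def)
    show "refl_on (carrier M) (least_congruence M T)"
      by (auto simp: least_congruence_def refl_on_def two_sided_congruence_def
          left_congruence_def equiv_def)
    show "sym (least_congruence M T)"
      unfolding least_congruence_def
      by (rule sym_INTER[where r = id, simplified])
        (auto simp: two_sided_congruence_def left_congruence_def equiv_def)
    show "trans (least_congruence M T)"
      unfolding least_congruence_def
      by (rule trans_INTER[where r = id, simplified])
        (auto simp: two_sided_congruence_def left_congruence_def equiv_def)
  qed
  moreover have "(s \<otimes>\<^bsub>M\<^esub> x, s \<otimes>\<^bsub>M\<^esub> y) \<in> least_congruence M T"
      "(x \<otimes>\<^bsub>M\<^esub> s, y \<otimes>\<^bsub>M\<^esub> s) \<in> least_congruence M T"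
    if "(x, y) \<in> least_congruence M T" and "s \<in> carrier M" for x y s
    using that unfolding least_congruence_def two_sided_congruence_def
      left_congruence_def right_congruence_def by blast+
  ultimately show ?thesis
    by (auto simp: two_sided_congruence_def left_congruence_def right_congruence_def)
qed

lemma least_congruence_subset:
  "two_sided_congruence M \<sigma> \<Longrightarrow> T \<subseteq> \<sigma> \<Longrightarrow> least_congruence M T \<subseteq> \<sigma>"
  by (auto simp: least_congruence_def)

lemma subset_least_congruence: "T \<subseteq> least_congruence M T"
  by (auto simp: least_congruence_def)

text \<open>
  A congruence containing a pair of distinct elements contains the principal congruence generated by
  that pair, and with it all generating pairs of the latter.
\<close>

lemma two_sided_congruence_trivial_if_misses_generating_pairs:
  assumes "monoid M" and K: "two_sided_congruence M K"
    and gen: "\<forall>\<sigma>. principal_congruence M \<sigma> \<longrightarrow> (\<exists>p \<in> Q. generating_pair M \<sigma> p)"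
    and disj: "Q \<inter> K = {}"
  shows "K \<subseteq> Id"
proof (rule subrelI, rule ccontr)
  fix s t assume st: "(s, t) \<in> K" "(s, t) \<notin> Id"
  let ?\<sigma> = "least_congruence M {(s, t)}"
  have mem: "(s, t) \<in> carrier M \<times> carrier M"
    using K st(1) by (auto simp: two_sided_congruence_def left_congruence_def equiv_def)
  then have "generating_pair M ?\<sigma> (s, t)"
    using st(2) by (simp add: generating_pair_def)
  then have "principal_congruence M ?\<sigma>"
    using two_sided_congruence_least_congruence[OF assms(1)] mem
    by (auto simp: principal_congruence_def)
  then obtain p where p: "p \<in> Q" "?\<sigma> = least_congruence M {p}"
    using gen by (auto simp: generating_pair_def)
  have "p \<in> ?\<sigma>"
    using subset_least_congruence[of "{p}" M] p(2) by simp
  also have "?\<sigma> \<subseteq> K"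
    using least_congruence_subset[OF K] st(1) by simp
  finally show False
    using p(1) disj by blast
qed

section \<open>Kernels of actions\<close>

definition action_kernel ::
    "('m, 'x) monoid_scheme \<Rightarrow> 'v set \<Rightarrow> ('v \<Rightarrow> 'm \<Rightarrow> 'v) \<Rightarrow> ('m \<times> 'm) set" where
  "action_kernel M V \<phi> =
     {(s, t) \<in> carrier M \<times> carrier M. \<forall>\<alpha> \<in> V. \<phi> \<alpha> s = \<phi> \<alpha> t}"

lemma two_sided_congruence_action_kernel:
  assumes "monoid M"
    and "\<And>\<alpha> s. \<alpha> \<in> V \<Longrightarrow> s \<in> carrier M \<Longrightarrow> \<phi> \<alpha> s \<in> V"
    and "\<And>\<alpha> s t. \<alpha> \<in> V \<Longrightarrow> s \<in> carrier M \<Longrightarrow> t \<in> carrier M \<Longrightarrow>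
           \<phi> \<alpha> (s \<otimes>\<^bsub>M\<^esub> t) = \<phi> (\<phi> \<alpha> s) t"
  shows "two_sided_congruence M (action_kernel M V \<phi>)"
proof -
  interpret monoid M by fact
  have "equiv (carrier M) (action_kernel M V \<phi>)"
    by (auto simp: action_kernel_def equiv_def refl_on_def sym_def trans_def)
  then show ?thesis
    unfolding two_sided_congruence_def left_congruence_def right_congruence_def
    using assms(2,3) by (auto simp: action_kernel_def)
qed

lemma faithful_iff_action_kernel: "faithful M V \<phi> \<longleftrightarrow> action_kernel M V \<phi> \<subseteq> Id"
  by (auto simp: faithful_def action_kernel_def)

section \<open>Reading words in a complete deterministic word graph\<close>

lemma monoid_free_monoid: "monoid (free_monoid A)"
  by (rule monoidI) (auto simp: free_monoid_def)

lemma labels_path_append: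
  "labels_path E \<alpha> u \<beta> \<Longrightarrow> labels_path E \<beta> v \<gamma> \<Longrightarrow> labels_path E \<alpha> (u @ v) \<gamma>"
  by (induction rule: labels_path.induct) (auto intro: labels_path.intros)

locale complete_deterministic_word_graph =
  fixes A :: "'a set" and V :: "nat set" and E :: "(nat \<times> 'a \<times> nat) set"
  assumes word_graph: "word_graph A V E"
    and complete: "complete_graph A V E"
    and deterministic: "deterministic_graph A V E"
begin

lemma labels_path_ex:
  "u \<in> lists A \<Longrightarrow> \<alpha> \<in> V \<Longrightarrow> \<exists>\<beta> \<in> V. labels_path E \<alpha> u \<beta>"
proof (induction u arbitrary: \<alpha>)
  case Nil
  then show ?case by (auto intro: labels_path.intros)
next
  case (Cons a u)
  then have "a \<in> A" "u \<in> lists A"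
    by simp_all
  then obtain \<beta> where edge: "(\<alpha>, a, \<beta>) \<in> E"
    using complete Cons.prems(2) unfolding complete_graph_def by blast
  have "\<beta> \<in> V"
    using edge word_graph unfolding word_graph_def by blast
  then obtain \<gamma> where "\<gamma> \<in> V" "labels_path E \<beta> u \<gamma>"
    using Cons.IH[OF \<open>u \<in> lists A\<close>] by blast
  then show ?case
    using labels_path.step[OF edge] by blast
qed

lemma labels_path_unique:
  "labels_path E \<alpha> u \<beta> \<Longrightarrow> labels_path E \<alpha> u \<gamma> \<Longrightarrow> \<beta> = \<gamma>"
proof (induction arbitrary: \<gamma> rule: labels_path.induct)
  case (empty \<alpha>)
  then show ?case by (auto elim: labels_path.cases)
next
  case (step \<alpha> a \<beta> u \<delta>)
  from step.prems obtain \<beta>' where \<beta>': "(\<alpha>, a, \<beta>') \<in> E" "labels_path E \<beta>' u \<gamma>"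
    by (auto elim: labels_path.cases)
  moreover have "\<beta> = \<beta>'"
    using deterministic word_graph step.hyps(1) \<beta>'(1)
    unfolding deterministic_graph_def word_graph_def by blast
  ultimately show ?case using step.IH by blast
qed

lemma target_eq_Some: "target E \<alpha> u = Some \<beta> \<longleftrightarrow> labels_path E \<alpha> u \<beta>"
proof
  assume "target E \<alpha> u = Some \<beta>"
  then show "labels_path E \<alpha> u \<beta>"
    unfolding target_def by (metis labels_path_unique option.discI option.inject theI)
next
  assume path: "labels_path E \<alpha> u \<beta>"
  then have "(THE \<gamma>. labels_path E \<alpha> u \<gamma>) = \<beta>"
    using labels_path_unique by blast
  then show "target E \<alpha> u = Some \<beta>"
    using path by (auto simp: target_def)
qed

text \<open>
  In a complete graph every word labels a path from every node, so the partial function \<open>target\<close> can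
  be replaced by this total one, which is a right action of the free monoid.
\<close>

definition read :: "nat \<Rightarrow> 'a list \<Rightarrow> nat" where
  "read \<alpha> u = the (target E \<alpha> u)"

lemma target_eq_read:
  assumes "u \<in> lists A" and "\<alpha> \<in> V"
  shows "target E \<alpha> u = Some (read \<alpha> u)"
  using labels_path_ex[OF assms] unfolding read_def by (auto simp flip: target_eq_Some)

lemma read_in: "u \<in> lists A \<Longrightarrow> \<alpha> \<in> V \<Longrightarrow> read \<alpha> u \<in> V"
  using labels_path_ex target_eq_read target_eq_Some labels_path_unique by metis

lemma read_append:
  assumes "u \<in> lists A" and "v \<in> lists A" and "\<alpha> \<in> V"
  shows "read \<alpha> (u @ v) = read (read \<alpha> u) v"
proof -
  have "labels_path E \<alpha> u (read \<alpha> u)" and "labels_path E (read \<alpha> u) v (read (read \<alpha> u) v)"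
    using assms by (simp_all add: read_in target_eq_read flip: target_eq_Some)
  then have "target E \<alpha> (u @ v) = Some (read (read \<alpha> u) v)"
    by (simp add: target_eq_Some labels_path_append)
  then show ?thesis
    by (simp add: read_def)
qed

text \<open>
  The kernel of the action of the free monoid is one of the congruences whose intersection is
  the congruence generated by \<open>R\<close>.
\<close>

lemma least_congruence_subset_read_kernel:
  assumes "compatible R V E" and "R \<subseteq> lists A \<times> lists A"
  shows "least_congruence (free_monoid A) R \<subseteq> action_kernel (free_monoid A) V read"
proof (rule least_congruence_subset)
  show "two_sided_congruence (free_monoid A) (action_kernel (free_monoid A) V read)"
    by (rule two_sided_congruence_action_kernel[OF monoid_free_monoid])
      (simp_all add: free_monoid_def read_in read_append)
  show "R \<subseteq> action_kernel (free_monoid A) V read"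
  proof (rule subrelI)
    fix u v assume "(u, v) \<in> R"
    then have words: "u \<in> lists A" "v \<in> lists A"
      using assms(2) by blast+
    have "read \<alpha> u = read \<alpha> v" if "\<alpha> \<in> V" for \<alpha>
    proof -
      have "target E \<alpha> u \<noteq> None \<and> target E \<alpha> v \<noteq> None \<longrightarrow> target E \<alpha> u = target E \<alpha> v"
        using assms(1) \<open>(u, v) \<in> R\<close> that unfolding compatible_def by blast
      then show ?thesis
        by (simp only: target_eq_read[OF words(1) that] target_eq_read[OF words(2) that]) simp
    qed
    then show "(u, v) \<in> action_kernel (free_monoid A) V read"
      using words by (simp add: action_kernel_def free_monoid_def)
  qed
qed

end

section \<open>The action of the presented monoid\<close>

locale compatible_word_graph = complete_deterministic_word_graph A V E
  for A :: "'a set" and V E +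
  fixes R :: "('a list \<times> 'a list) set" and M :: "('m, 'x) monoid_scheme"
    and \<theta> :: "'a list \<Rightarrow> 'm"
  assumes presentation: "monoid_presentation A R M \<theta>"
    and compatible: "compatible R V E"
begin

lemma monoid_M: "monoid M"
  using presentation by (simp add: monoid_presentation_def)

lemma image_carrier: "\<theta> ` lists A = carrier M"
  using presentation by (simp add: monoid_presentation_def)

lemma image_append:
  "u \<in> lists A \<Longrightarrow> v \<in> lists A \<Longrightarrow> \<theta> (u @ v) = \<theta> u \<otimes>\<^bsub>M\<^esub> \<theta> v"
  using presentation by (auto simp: monoid_presentation_def hom_def free_monoid_def)

lemma read_eq_if_image_eq:
  assumes "u \<in> lists A" and "v \<in> lists A" and "\<theta> u = \<theta> v" and "\<alpha> \<in> V"
  shows "read \<alpha> u = read \<alpha> v"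
proof -
  have "(u, v) \<in> least_congruence (free_monoid A) R"
    using presentation assms unfolding monoid_presentation_def by blast
  also have "\<dots> \<subseteq> action_kernel (free_monoid A) V read"
    using compatible presentation
    by (intro least_congruence_subset_read_kernel) (auto simp: monoid_presentation_def)
  finally show ?thesis
    using assms(4) by (simp add: action_kernel_def)
qed

lemma right_action_image:
  assumes "u \<in> lists A" and "\<alpha> \<in> V"
  shows "right_action A \<theta> E \<alpha> (\<theta> u) = read \<alpha> u"
  unfolding right_action_def
proof (rule the_equality)
  show "\<exists>w \<in> lists A. \<theta> w = \<theta> u \<and> target E \<alpha> w = Some (read \<alpha> u)"
    using assms target_eq_read by blast
next
  fix \<beta> assume "\<exists>w \<in> lists A. \<theta> w = \<theta> u \<and> target E \<alpha> w = Some \<beta>"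
  then obtain w where "w \<in> lists A" "\<theta> w = \<theta> u" "target E \<alpha> w = Some \<beta>"
    by blast
  then show "\<beta> = read \<alpha> u"
    using assms target_eq_read[of w \<alpha>] read_eq_if_image_eq[of w u \<alpha>] by simp
qed

lemma two_sided_congruence_right_action_kernel:
  "two_sided_congruence M (action_kernel M V (right_action A \<theta> E))"
proof (rule two_sided_congruence_action_kernel[OF monoid_M])
  fix \<alpha> s assume "\<alpha> \<in> V" "s \<in> carrier M"
  then obtain u where "u \<in> lists A" "s = \<theta> u"
    using image_carrier by blast
  then show "right_action A \<theta> E \<alpha> s \<in> V"
    using \<open>\<alpha> \<in> V\<close> by (simp only: right_action_image read_in)
next
  fix \<alpha> s t assume *: "\<alpha> \<in> V" "s \<in> carrier M" "t \<in> carrier M"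
  then obtain u v where uv: "u \<in> lists A" "v \<in> lists A" and st: "s = \<theta> u" "t = \<theta> v"
    using image_carrier by blast
  have "right_action A \<theta> E \<alpha> (s \<otimes>\<^bsub>M\<^esub> t) = right_action A \<theta> E \<alpha> (\<theta> (u @ v))"
    by (simp only: image_append[OF uv] st)
  also have "\<dots> = read \<alpha> (u @ v)"
    using uv by (intro right_action_image[OF _ *(1)]) simp
  also have "\<dots> = read (read \<alpha> u) v"
    by (rule read_append[OF uv *(1)])
  also have "\<dots> = right_action A \<theta> E (read \<alpha> u) t"
    unfolding st by (rule right_action_image[OF uv(2) read_in[OF uv(1) *(1)], symmetric])
  also have "read \<alpha> u = right_action A \<theta> E \<alpha> s"
    unfolding st by (rule right_action_image[OF uv(1) *(1), symmetric])
  finally show "right_action A \<theta> E \<alpha> (s \<otimes>\<^bsub>M\<^esub> t) =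
      right_action A \<theta> E (right_action A \<theta> E \<alpha> s) t" .
qed

lemma image_in_right_action_kernel_iff:
  assumes "u \<in> lists A" and "v \<in> lists A"
  shows "(\<theta> u, \<theta> v) \<in> action_kernel M V (right_action A \<theta> E) \<longleftrightarrow>
    (\<forall>\<alpha> \<in> V. target E \<alpha> u = target E \<alpha> v)"
proof -
  have "\<theta> u \<in> carrier M" "\<theta> v \<in> carrier M"
    using imageI[OF assms(1), of \<theta>] imageI[OF assms(2), of \<theta>]
    unfolding image_carrier by this+
  then show ?thesis
    by (simp add: action_kernel_def right_action_image[OF assms(1)]
        right_action_image[OF assms(2)] target_eq_read[OF assms(1)] target_eq_read[OF assms(2)])
qed

end

section \<open>Faithfulness is decided by representatives of generating pairs\<close>

theorem theorem5p9:
  fixes A :: "'a::linorder set"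
    and R P :: "('a list \<times> 'a list) set"
    and M :: "('m, 'x) monoid_scheme"
    and \<theta> :: "'a list \<Rightarrow> 'm"
    and \<rho> :: "('m \<times> 'm) set"
    and V :: "nat set"
    and E :: "(nat \<times> 'a \<times> nat) set"
    and \<Psi> :: "nat \<Rightarrow> 'm \<Rightarrow> nat"
  assumes "monoid_presentation A R M \<theta>"
    and "right_congruence M \<rho>"
    and "word_graph_of_congruence A R \<theta> \<rho> V E"
    and "\<Psi> = right_action A \<theta> E"
    and "P \<subseteq> lists A \<times> lists A"
    and "\<forall>\<sigma>. principal_congruence M \<sigma> \<longrightarrow> (\<exists>p \<in> map_prod \<theta> \<theta> ` P. generating_pair M \<sigma> p)"
  shows "((\<forall>(u, v) \<in> P. \<theta> u \<noteq> \<theta> v) \<longrightarrow>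
           (faithful M V \<Psi> \<longleftrightarrow> (\<forall>(u, v) \<in> P. \<exists>\<alpha> \<in> V. target E \<alpha> u \<noteq> target E \<alpha> v))) \<and>
         ((\<forall>(u, v) \<in> P. \<exists>\<alpha> \<in> V. target E \<alpha> u \<noteq> target E \<alpha> v) \<longrightarrow> faithful M V \<Psi>)"
proof -
  interpret compatible_word_graph A V E R M \<theta>
    using assms(1,3)
    by unfold_locales (simp_all only: word_graph_of_congruence_def standard_complete_def)
  let ?K = "action_kernel M V \<Psi>"
  let ?sep = "\<forall>(u, v) \<in> P. \<exists>\<alpha> \<in> V. target E \<alpha> u \<noteq> target E \<alpha> v"
  have K_iff: "(\<theta> u, \<theta> v) \<in> ?K \<longleftrightarrow> (\<forall>\<alpha> \<in> V. target E \<alpha> u = target E \<alpha> v)"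
    if "(u, v) \<in> P" for u v
  proof -
    have "u \<in> lists A" "v \<in> lists A"
      using that assms(5) by blast+
    then show ?thesis
      using image_in_right_action_kernel_iff assms(4) by simp
  qed
  have "faithful M V \<Psi>" if ?sep
  proof -
    have "map_prod \<theta> \<theta> ` P \<inter> ?K = {}"
      using that K_iff by blast
    then have "?K \<subseteq> Id"
      using two_sided_congruence_trivial_if_misses_generating_pairs monoid_M
        two_sided_congruence_right_action_kernel assms(4,6) by blast
    then show ?thesis
      by (simp add: faithful_iff_action_kernel)
  qed
  moreover have ?sep if "\<forall>(u, v) \<in> P. \<theta> u \<noteq> \<theta> v" and "faithful M V \<Psi>"
    using that K_iff by (fastforce simp: faithful_iff_action_kernel)
  ultimately show ?thesis
    by blast
qed

end
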